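(* Let $W_L=(\rho_L,\rho_L u_L,E_L)\in\Omega$ and $W_R=(\rho_R,\rho_R u_R,E_R)\in\Omega$ be two given states, and let $\lambda$ be a wave speed satisfying $\lambda\ge\max\big(|u_L|+c(W_L),\,|u_R|+c(W_R)\big)$ and such that $\rho_{\mathrm{HLL}}>0$. Then, for all convex smooth functions $\eta:\mathbb{R}\to\mathbb{R}$, $$\eta\left(\frac{(\rho s)_{\mathrm{HLL}}}{\rho_{\mathrm{HLL}}}\right)\le\frac{\big(\rho\,\eta(s)\big)_{\mathrm{HLL}}}{\rho_{\mathrm{HLL}}}.$$
   Context: Fix $\gamma>1$. For a state $W=(\rho,\rho u,E)\in\mathbb{R}^3$ with $\rho>0$, the pressure is $p=(\gamma-1)\left(E-\tfrac12\rho u^2\right)$. The set of admissible states is $\Omega=\{W\in\mathbb{R}^3:\rho>0,\ p>0\}$. The sound speed is $c(W)=\sqrt{\gamma p/\rho}$ and the specific entropy is $s=s(W)=-\log(p/\rho^\gamma)$; write $s_L=s(W_L)$, $s_R=s(W_R)$. Define $$\rho_{\mathrm{HLL}}=\tfrac12(\rho_L+\rho_R)-\tfrac1{2\lambda}(\rho_Ru_R-\rho_Lu_L),$$ $$(\rho s)_{\mathrm{HLL}}=\tfrac12(\rho_Ls_L+\rho_Rs_R)-\tfrac1{2\lambda}(\rho_Rs_Ru_R-\rho_Ls_Lu_L),$$ $$(\rho\,\eta(s))_{\mathrm{HLL}}=\tfrac12\big(\rho_L\eta(s_L)+\rho_R\eta(s_R)\big)-\tfrac1{2\lambda}\big(\rho_R\eta(s_R)u_R-\rho_L\eta(s_L)u_L\big).$$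 *)

theory Defs
  imports "HOL-Analysis.Analysis"
begin

text \<open>
  States \<open>W = (\<rho>, \<rho> u, E)\<close> are vectors of type \<open>real ^ 3\<close> holding the conserved variables
  in the components 1, 2, 3; the velocity is recovered from the momentum.
\<close>

definition density :: "real ^ 3 \<Rightarrow> real" where
  "density W = W $ 1"

definition velocity :: "real ^ 3 \<Rightarrow> real" where
  "velocity W = W $ 2 / W $ 1"

definition energy :: "real ^ 3 \<Rightarrow> real" where
  "energy W = W $ 3"

definition pressure :: "real \<Rightarrow> real ^ 3 \<Rightarrow> real" where
  "pressure \<gamma> W = (\<gamma> - 1) * (energy W - 1 / 2 * density W * (velocity W)\<^sup>2)"

definition admissible :: "real \<Rightarrow> (real ^ 3) set" where
  "admissible \<gamma> = {W. density W > 0 \<and> pressure \<gamma> W > 0}"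

definition sound_speed :: "real \<Rightarrow> real ^ 3 \<Rightarrow> real" where
  "sound_speed \<gamma> W = sqrt (\<gamma> * pressure \<gamma> W / density W)"

definition entropy :: "real \<Rightarrow> real ^ 3 \<Rightarrow> real" where
  "entropy \<gamma> W = - ln (pressure \<gamma> W / density W powr \<gamma>)"

definition rho_HLL :: "real \<Rightarrow> real ^ 3 \<Rightarrow> real ^ 3 \<Rightarrow> real" where
  "rho_HLL lam WL WR =
     1 / 2 * (density WL + density WR)
     - 1 / (2 * lam) * (density WR * velocity WR - density WL * velocity WL)"

definition rho_s_HLL :: "real \<Rightarrow> real \<Rightarrow> real ^ 3 \<Rightarrow> real ^ 3 \<Rightarrow> real" where
  "rho_s_HLL \<gamma> lam WL WR =
     1 / 2 * (density WL * entropy \<gamma> WL + density WR * entropy \<gamma> WR)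
     - 1 / (2 * lam) * (density WR * entropy \<gamma> WR * velocity WR
                        - density WL * entropy \<gamma> WL * velocity WL)"

definition rho_eta_HLL ::
  "real \<Rightarrow> (real \<Rightarrow> real) \<Rightarrow> real \<Rightarrow> real ^ 3 \<Rightarrow> real ^ 3 \<Rightarrow> real" where
  "rho_eta_HLL \<gamma> \<eta> lam WL WR =
     1 / 2 * (density WL * \<eta> (entropy \<gamma> WL) + density WR * \<eta> (entropy \<gamma> WR))
     - 1 / (2 * lam) * (density WR * \<eta> (entropy \<gamma> WR) * velocity WR
                        - density WL * \<eta> (entropy \<gamma> WL) * velocity WL)"

text \<open>Smooth means \<open>C\<^sup>\<infinity>\<close>: every iterated derivative exists everywhere.\<close>

definition smooth :: "(real \<Rightarrow> real) \<Rightarrow> bool" where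
  "smooth f \<longleftrightarrow> (\<forall>n x. (deriv ^^ n) f differentiable (at x))"

end

(* With a = (rho_L / 2) (1 + u_L / lam) and b = (rho_R / 2) (1 - u_R / lam), the three HLL averages
   are a + b, a s_L + b s_R and a eta(s_L) + b eta(s_R).  The bound on the wave speed makes both
   weights nonnegative, so the claim is Jensen's inequality for two points. *)
theory Submission
  imports Defs
begin

text \<open>Two-point Jensen with unnormalised weights: dividing them by \<open>a + b\<close> yields
  the coefficients of a convex combination.\<close>

lemma convex_on_weighted_mean_le:
  fixes f :: "real \<Rightarrow> real"
  assumes "convex_on UNIV f" "a \<ge> 0" "b \<ge> 0" "a + b > 0"
  shows "f ((a * x + b * y) / (a + b)) \<le> (a * f x + b * f y) / (a + b)"
proof -
  have "a / (a + b) + b / (a + b) = 1"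
    using assms(4) by (simp add: add_divide_distrib[symmetric])
  then have "f ((a / (a + b)) *\<^sub>R x + (b / (a + b)) *\<^sub>R y)
      \<le> a / (a + b) * f x + b / (a + b) * f y"
    using assms unfolding convex_on_def
    by (metis UNIV_I divide_nonneg_pos)
  then show ?thesis
    by (simp add: add_divide_distrib)
qed

lemma sound_speed_pos:
  assumes "\<gamma> > 1" "W \<in> admissible \<gamma>"
  shows "sound_speed \<gamma> W > 0"
  using assms by (simp add: sound_speed_def admissible_def)

theorem theorem3p5:
  fixes \<gamma> lam :: real and WL WR :: "real ^ 3"
  assumes "\<gamma> > 1"
    and "WL \<in> admissible \<gamma>" and "WR \<in> admissible \<gamma>"
    and "lam \<ge> max (\<bar>velocity WL\<bar> + sound_speed \<gamma> WL) (\<bar>velocity WR\<bar> + sound_speed \<gamma> WR)"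
    and "rho_HLL lam WL WR > 0"
  shows "\<forall>\<eta> :: real \<Rightarrow> real. convex_on UNIV \<eta> \<and> smooth \<eta> \<longrightarrow>
           \<eta> (rho_s_HLL \<gamma> lam WL WR / rho_HLL lam WL WR)
             \<le> rho_eta_HLL \<gamma> \<eta> lam WL WR / rho_HLL lam WL WR"
proof (intro allI impI)
  fix \<eta> :: "real \<Rightarrow> real"
  assume \<eta>: "convex_on UNIV \<eta> \<and> smooth \<eta>"
  define a where "a = density WL / 2 * (1 + velocity WL / lam)"
  define b where "b = density WR / 2 * (1 - velocity WR / lam)"
  \<comment> \<open>Positive sound speeds make the velocity bounds strict, which forces
    \<open>lam > 0\<close> and so permits division by \<open>lam\<close>.\<close>
  have speeds: "\<bar>velocity WL\<bar> < lam" "\<bar>velocity WR\<bar> < lam"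
    using sound_speed_pos[OF assms(1,2)] sound_speed_pos[OF assms(1,3)] assms(4) by auto
  then have "lam > 0"
    by linarith
  then have "1 + velocity WL / lam \<ge> 0" "1 - velocity WR / lam \<ge> 0"
    using speeds by (auto simp: field_simps)
  then have "a \<ge> 0" "b \<ge> 0"
    using assms(2,3) by (simp_all add: a_def b_def admissible_def)
  \<comment> \<open>All three averages are the same linear expression in the left and right values
    of a quantity, taken to be 1, the entropy and \<eta> of the entropy in turn, so the same weights
    serve each. For the quantity 1, positivity of \<open>rho_HLL\<close> becomes
    \<open>a + b > 0\<close>, as Jensen requires.\<close>
  moreover have rho: "rho_HLL lam WL WR = a + b"
    using \<open>lam > 0\<close> by (simp add: rho_HLL_def a_def b_def field_simps)
  moreover have "rho_s_HLL \<gamma> lam WL WR = a * entropy \<gamma> WL + b * entropy \<gamma> WR"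
    using \<open>lam > 0\<close> by (simp add: rho_s_HLL_def a_def b_def field_simps)
  moreover have "rho_eta_HLL \<gamma> \<eta> lam WL WR
      = a * \<eta> (entropy \<gamma> WL) + b * \<eta> (entropy \<gamma> WR)"
    using \<open>lam > 0\<close> by (simp add: rho_eta_HLL_def a_def b_def field_simps)
  ultimately show "\<eta> (rho_s_HLL \<gamma> lam WL WR / rho_HLL lam WL WR)
      \<le> rho_eta_HLL \<gamma> \<eta> lam WL WR / rho_HLL lam WL WR"
    using convex_on_weighted_mean_le \<eta> assms(5) by simp
qed

end
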